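(* For any policy that chooses at most one key term per time step, there exists an instance of the conversational bandit problem (with finite and time-varying arm sets) such that the expected regret $\mathbb E[\mathrm{Reg}(T)]$ is at least $\Omega(\sqrt{dT})$. Furthermore, for any $T=2^m$ with $m\in\{1,\dots,d\}$, the regret is at least $\Omega(\sqrt{dT\log(T)})$.
   Context: Conversational bandit problem with horizon $T$ and dimension $d$. An instance consists of a preference vector $\theta^*\in\mathbb R^d$, unknown to the policy, with $\|\theta^*\|_2\le1$; a finite arm set $\mathcal A$ with feature vectors $x_a\in\mathbb R^d$, $\|x_a\|_2=1$; arm subsets $\mathcal A_t\subseteq\mathcal A$ for $t=1,\dots,T$, which may vary with $t$; and a finite key term set $\mathcal K$ with context vectors $\tilde x_k\in\mathbb R^d$, $\|\tilde x_k\|_2=1$. In round $t$ the policy selects an arm $a_t\in\mathcal A_t$ and receives the reward $x_{a_t}^\top\theta^*+\eta_t$; it may also select a key term $k\in\mathcal K$ and then receives the feedback $\tilde x_k^\top\theta^*+\tilde\eta_t$. The noises $\eta_t,\tilde\eta_t$ are conditionally independent and 1-sub-Gaussian. A policy is a pair of rules, one selecting arms and one selecting key terms (possibly none in a given round), based on the history of past selections and feedback. The regret is $\mathrm{Reg}(T)=\sum_{t=1}^T\left(\max_{a\in\mathcal A_t}x_a^\top\theta^*-x_{a_t}^\top\theta^*\right)$.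
   Formalization: The bounds are proved as c·min(T, √(dT)) and c·min(T, √(dT log T)) with a universal constant c, since the regret never exceeds 2T and the untruncated bounds fail when d is much larger than T. *)

theory Defs
  imports "HOL-Probability.Probability"
begin

text \<open>
  The dimension is quantified inside the theorem (the constant must not depend on it), so a vector
  of \<open>\<real>\<^sup>d\<close> is a function \<open>nat \<Rightarrow> real\<close> of which only the coordinates below \<open>d\<close> matter; its Euclidean
  norm is \<open>L2_set x {..<d}\<close>. Arms and key terms are labelled by natural numbers and rounds are
  numbered \<open>0, \<dots>, T - 1\<close>.
\<close>

definition inner_dim :: "nat \<Rightarrow> (nat \<Rightarrow> real) \<Rightarrow> (nat \<Rightarrow> real) \<Rightarrow> real" where
  "inner_dim d x y = (\<Sum>i<d. x i * y i)"

text \<open>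
  The record of one round: the key term selected (\<open>None\<close> if there is none), its feedback (\<open>0\<close> by
  convention if there is none), the arm selected, and its reward.
\<close>

type_synonym round = "nat option \<times> real \<times> nat \<times> real"

type_synonym history = "nat \<Rightarrow> round"

definition round_space :: "round measure" where
  "round_space = count_space UNIV \<Otimes>\<^sub>M borel \<Otimes>\<^sub>M count_space UNIV \<Otimes>\<^sub>M borel"

text \<open>The past available at the beginning of round \<open>t\<close>.\<close>

definition history_space :: "nat \<Rightarrow> history measure" where
  "history_space t = PiM {0..<t} (\<lambda>_. round_space)"

text \<open>The part of an instance that is known to the policy.\<close>

record bandit_setting =
  arms :: "nat set"
  arm_vec :: "nat \<Rightarrow> nat \<Rightarrow> real"
  arm_sets :: "nat \<Rightarrow> nat set"
  key_terms :: "nat set"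
  key_vec :: "nat \<Rightarrow> nat \<Rightarrow> real"

text \<open>
  Requiring a key term to exist excludes instances in which the conversational feedback is switched
  off by an empty key term set.
\<close>

definition bandit_setting_valid :: "nat \<Rightarrow> nat \<Rightarrow> bandit_setting \<Rightarrow> bool" where
  "bandit_setting_valid d T S \<longleftrightarrow>
     finite (arms S) \<and> (\<forall>a\<in>arms S. L2_set (arm_vec S a) {..<d} = 1) \<and>
     (\<forall>t<T. arm_sets S t \<noteq> {} \<and> arm_sets S t \<subseteq> arms S) \<and>
     finite (key_terms S) \<and> key_terms S \<noteq> {} \<and>
     (\<forall>k\<in>key_terms S. L2_set (key_vec S k) {..<d} = 1)"

text \<open>
  A full instance adds the unknown preference vector and the noise. The noise is given by its
  conditional laws: \<open>key_noise I t h k\<close> is the law of the key-term noise in round \<open>t\<close> given the past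
  \<open>h\<close> and the selected key term \<open>k\<close>; \<open>arm_noise I t h k a\<close> is the law of the reward noise in round
  \<open>t\<close> given the past \<open>h\<close> and the selections \<open>k\<close> and \<open>a\<close> of that round. That the latter does not
  take the current key-term noise as an argument is the conditional independence of the two noises.
\<close>

record bandit_instance =
  setting :: bandit_setting
  theta :: "nat \<Rightarrow> real"
  key_noise :: "nat \<Rightarrow> history \<Rightarrow> nat \<Rightarrow> real measure"
  arm_noise :: "nat \<Rightarrow> history \<Rightarrow> nat option \<Rightarrow> nat \<Rightarrow> real measure"

text \<open>The moment generating function bound for all real \<open>\<lambda>\<close> forces the mean to be zero.\<close>

definition sub_gaussian :: "real \<Rightarrow> real measure \<Rightarrow> bool" where
  "sub_gaussian \<sigma> \<nu> \<longleftrightarrow>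
     (\<forall>l::real. integrable \<nu> (\<lambda>x. exp (l * x)) \<and>
        (\<integral>x. exp (l * x) \<partial>\<nu>) \<le> exp (\<sigma>\<^sup>2 * l\<^sup>2 / 2))"

text \<open>
  The noise conditions are imposed for all labels and rounds, also for those that never occur; this
  is no restriction, since the noise laws can be redefined there at will.
\<close>

definition bandit_instance_valid :: "nat \<Rightarrow> nat \<Rightarrow> bandit_instance \<Rightarrow> bool" where
  "bandit_instance_valid d T I \<longleftrightarrow>
     bandit_setting_valid d T (setting I) \<and> L2_set (theta I) {..<d} \<le> 1 \<and>
     (\<forall>t k. (\<lambda>h. key_noise I t h k) \<in> history_space t \<rightarrow>\<^sub>M prob_algebra borel) \<and>
     (\<forall>t k a. (\<lambda>h. arm_noise I t h k a) \<in> history_space t \<rightarrow>\<^sub>M prob_algebra borel) \<and>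
     (\<forall>t k. \<forall>h\<in>space (history_space t). sub_gaussian 1 (key_noise I t h k)) \<and>
     (\<forall>t k a. \<forall>h\<in>space (history_space t). sub_gaussian 1 (arm_noise I t h k a))"

text \<open>
  Both rules may randomise and may use everything but the preference vector and the noise laws (in
  particular the whole sequence of arm subsets). In round \<open>t\<close> the key term is drawn from
  \<open>key_rule \<pi> S t h\<close>, where \<open>h\<close> is the past; then, after the feedback \<open>y\<close> of the key term \<open>k\<close> has
  been observed, the arm is drawn from \<open>arm_rule \<pi> S t h k y\<close>. Policies whose arm rule ignores \<open>y\<close>,
  or \<open>k\<close> and \<open>y\<close>, are included, and so are deterministic ones.
\<close>

record bandit_policy =
  key_rule :: "bandit_setting \<Rightarrow> nat \<Rightarrow> history \<Rightarrow> nat option pmf"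
  arm_rule :: "bandit_setting \<Rightarrow> nat \<Rightarrow> history \<Rightarrow> nat option \<Rightarrow> real \<Rightarrow> nat pmf"

definition bandit_policy_valid :: "nat \<Rightarrow> nat \<Rightarrow> bandit_policy \<Rightarrow> bool" where
  "bandit_policy_valid d T \<pi> \<longleftrightarrow> (\<forall>S. bandit_setting_valid d T S \<longrightarrow>
     (\<forall>t. (\<lambda>h. measure_pmf (key_rule \<pi> S t h))
            \<in> history_space t \<rightarrow>\<^sub>M prob_algebra (count_space UNIV)) \<and>
     (\<forall>t k. (\<lambda>(h, y). measure_pmf (arm_rule \<pi> S t h k y))
            \<in> history_space t \<Otimes>\<^sub>M borel \<rightarrow>\<^sub>M prob_algebra (count_space UNIV)) \<and>
     (\<forall>t<T. \<forall>h\<in>space (history_space t).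
        set_pmf (key_rule \<pi> S t h) \<subseteq> insert None (Some ` key_terms S) \<and>
        (\<forall>k y. set_pmf (arm_rule \<pi> S t h k y) \<subseteq> arm_sets S t)))"

primrec feedback_law ::
  "nat \<Rightarrow> bandit_instance \<Rightarrow> nat \<Rightarrow> history \<Rightarrow> nat option \<Rightarrow> real measure" where
  "feedback_law d I t h None = return borel 0"
| "feedback_law d I t h (Some k) =
     distr (key_noise I t h k) borel (\<lambda>e. inner_dim d (key_vec (setting I) k) (theta I) + e)"

definition reward_law ::
  "nat \<Rightarrow> bandit_instance \<Rightarrow> nat \<Rightarrow> history \<Rightarrow> nat option \<Rightarrow> nat \<Rightarrow> real measure" where
  "reward_law d I t h k a =
     distr (arm_noise I t h k a) borel (\<lambda>e. inner_dim d (arm_vec (setting I) a) (theta I) + e)"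

definition round_law ::
  "nat \<Rightarrow> bandit_policy \<Rightarrow> bandit_instance \<Rightarrow> nat \<Rightarrow> history \<Rightarrow> round measure" where
  "round_law d \<pi> I t h =
     measure_pmf (key_rule \<pi> (setting I) t h) \<bind> (\<lambda>k.
     feedback_law d I t h k \<bind> (\<lambda>y.
     measure_pmf (arm_rule \<pi> (setting I) t h k y) \<bind> (\<lambda>a.
     reward_law d I t h k a \<bind> (\<lambda>r.
     return round_space (k, y, a, r)))))"

text \<open>
  The law of the history of the first \<open>T\<close> rounds, as the Ionescu-Tulcea composition of the kernels
  \<open>round_law\<close> for the rounds \<open>0, \<dots>, T - 1\<close>, started from the empty history.
\<close>

definition history_law ::
  "nat \<Rightarrow> nat \<Rightarrow> bandit_policy \<Rightarrow> bandit_instance \<Rightarrow> history measure" where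
  "history_law d T \<pi> I =
     Ionescu_Tulcea.C (round_law d \<pi> I) (\<lambda>_. round_space) 0 T (\<lambda>_. undefined)"

definition selected_arm :: "round \<Rightarrow> nat" where
  "selected_arm = (\<lambda>(k, y, a, r). a)"

definition regret :: "nat \<Rightarrow> nat \<Rightarrow> bandit_instance \<Rightarrow> history \<Rightarrow> real" where
  "regret d T I h = (\<Sum>t<T.
     Max ((\<lambda>a. inner_dim d (arm_vec (setting I) a) (theta I)) ` arm_sets (setting I) t)
     - inner_dim d (arm_vec (setting I) (selected_arm (h t))) (theta I))"

text \<open>
  Since \<open>\<parallel>\<theta>\<parallel> \<le> 1\<close> and \<open>\<parallel>x\<^sub>a\<parallel> = 1\<close>, the regret never exceeds \<open>2 * T\<close>. A lower bound of order
  \<open>B(d, T)\<close> that is uniform in \<open>d\<close> and \<open>T\<close> can therefore only hold in the form \<open>c * min T (B(d, T))\<close>,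
  which is \<open>c * B(d, T)\<close> as soon as \<open>B(d, T) \<le> T\<close>; for \<open>B(d, T) = sqrt (d * T)\<close> this means \<open>d \<le> T\<close>.
\<close>

definition expected_regret :: "nat \<Rightarrow> nat \<Rightarrow> bandit_policy \<Rightarrow> bandit_instance \<Rightarrow> real" where
  "expected_regret d T \<pi> I = (\<integral>h. regret d T I h \<partial>history_law d T \<pi> I)"

lemma measurable_bind_countable_prob_space:
  fixes g :: "'a \<Rightarrow> 'i::countable \<Rightarrow> 'b measure"
  assumes f: "f \<in> M \<rightarrow>\<^sub>M prob_algebra (count_space UNIV)"
    and g: "\<And>i. (\<lambda>x. g x i) \<in> M \<rightarrow>\<^sub>M prob_algebra R"
  shows "(\<lambda>x. bind (f x) (g x)) \<in> M \<rightarrow>\<^sub>M prob_algebra R"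
proof (rule measurable_bind_prob_space2[OF f])
  have "(\<lambda>z. g (fst z) (snd z)) \<in> M \<Otimes>\<^sub>M count_space UNIV \<rightarrow>\<^sub>M prob_algebra R"
    by (rule measurable_compose_countable[where f = "\<lambda>i z. g (fst z) i"])
      (auto intro: measurable_compose[OF measurable_fst g])
  then show "(\<lambda>(x, y). g x y) \<in> M \<Otimes>\<^sub>M count_space UNIV \<rightarrow>\<^sub>M prob_algebra R"
    by (simp add: case_prod_beta')
qed

text \<open>The kernels compose, so that the law of the history is a probability measure.\<close>

lemma Ionescu_Tulcea_round_law:
  assumes I: "bandit_instance_valid d T I" and \<pi>: "bandit_policy_valid d T \<pi>"
  shows "Ionescu_Tulcea (round_law d \<pi> I) (\<lambda>_. round_space)"
proof -
  define S where "S = setting I"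
  have S: "bandit_setting_valid d T S"
    using I by (simp add: bandit_instance_valid_def S_def)
  have K: "(\<lambda>h. measure_pmf (key_rule \<pi> S t h)) 
      \<in> history_space t \<rightarrow>\<^sub>M prob_algebra (count_space UNIV)" for t
    using \<pi> S by (simp add: bandit_policy_valid_def)
  have A: "(\<lambda>(h, y). measure_pmf (arm_rule \<pi> S t h k y))
      \<in> history_space t \<Otimes>\<^sub>M borel \<rightarrow>\<^sub>M prob_algebra (count_space UNIV)" for t k
    using \<pi> S by (simp add: bandit_policy_valid_def)
  have [measurable]: "(\<lambda>h. key_noise I t h k) \<in> history_space t \<rightarrow>\<^sub>M prob_algebra borel" for t k
    using I by (simp add: bandit_instance_valid_def)
  have [measurable]: "(\<lambda>h. arm_noise I t h k a) \<in> history_space t \<rightarrow>\<^sub>M prob_algebra borel" for t k a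
    using I by (simp add: bandit_instance_valid_def)
  have F: "(\<lambda>h. feedback_law d I t h k) \<in> history_space t \<rightarrow>\<^sub>M prob_algebra borel" for t k
  proof (cases k)
    case None
    then show ?thesis by (simp add: space_prob_algebra prob_space_return)
  next
    case (Some j)
    show ?thesis unfolding Some feedback_law.simps
      by (rule measurable_distr_prob_space2[where M = borel]) measurable
  qed
  have R: "(\<lambda>h. reward_law d I t h k a) \<in> history_space t \<rightarrow>\<^sub>M prob_algebra borel" for t k a
    unfolding reward_law_def
    by (rule measurable_distr_prob_space2[where M = borel]) measurable
  have k1: "(\<lambda>x. reward_law d I t (fst x) k a \<bind> (\<lambda>r. return round_space (k, snd x, a, r)))
      \<in> history_space t \<Otimes>\<^sub>M borel \<rightarrow>\<^sub>M prob_algebra round_space" for t k a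
  proof (rule measurable_bind_prob_space2[where N = borel])
    show "(\<lambda>x. reward_law d I t (fst x) k a) \<in> history_space t \<Otimes>\<^sub>M borel \<rightarrow>\<^sub>M prob_algebra borel"
      by (rule measurable_compose[OF measurable_fst R])
    have "(\<lambda>z. (k, snd (fst z), a, snd z))
        \<in> (history_space t \<Otimes>\<^sub>M borel) \<Otimes>\<^sub>M borel \<rightarrow>\<^sub>M round_space"
      unfolding round_space_def by measurable
    from measurable_compose[OF this measurable_return_prob_space]
    show "(\<lambda>(x, r). return round_space (k, snd x, a, r))
        \<in> (history_space t \<Otimes>\<^sub>M borel) \<Otimes>\<^sub>M borel \<rightarrow>\<^sub>M prob_algebra round_space"
      by (simp add: case_prod_beta')
  qed
  have k2: "(\<lambda>x. measure_pmf (arm_rule \<pi> S t (fst x) k (snd x)) \<bind> (\<lambda>a.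
        reward_law d I t (fst x) k a \<bind> (\<lambda>r. return round_space (k, snd x, a, r))))
      \<in> history_space t \<Otimes>\<^sub>M borel \<rightarrow>\<^sub>M prob_algebra round_space" for t k
    using A[of t k] by (intro measurable_bind_countable_prob_space k1) (simp add: case_prod_beta')
  have k3: "(\<lambda>h. feedback_law d I t h k \<bind> (\<lambda>y. measure_pmf (arm_rule \<pi> S t h k y) \<bind> (\<lambda>a.
        reward_law d I t h k a \<bind> (\<lambda>r. return round_space (k, y, a, r)))))
      \<in> history_space t \<rightarrow>\<^sub>M prob_algebra round_space" for t k
    using k2[of t k]
    by (intro measurable_bind_prob_space2[where N = borel] F) (simp add: case_prod_beta')
  have P: "round_law d \<pi> I t \<in> history_space t \<rightarrow>\<^sub>M prob_algebra round_space" for t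
    using measurable_bind_countable_prob_space[OF K k3, of t]
    by (simp add: round_law_def[abs_def] S_def)
  show ?thesis
  proof (rule Ionescu_Tulcea.intro)
    fix t h
    show "round_law d \<pi> I t \<in> PiM {0..<t} (\<lambda>_. round_space) \<rightarrow>\<^sub>M subprob_algebra round_space"
      using P[of t] by (simp add: history_space_def measurable_prob_algebraD)
    assume "h \<in> space (PiM {0..<t} (\<lambda>_. round_space))"
    then show "prob_space (round_law d \<pi> I t h)"
      using measurable_space[OF P[of t]] by (simp add: history_space_def space_prob_algebra)
  qed
qed

end

theory Submission
  imports Defs
begin

text \<open>
  Take as arms the \<open>2\<^sup>d\<close> vectors with coordinates \<open>\<plusminus>1 / sqrt d\<close>, as only key term one of the same
  vectors, standard normal noise, and as preference vector a multiple of a sign vector \<open>A\<close>. Each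
  coordinate of the selected arm whose sign disagrees with \<open>A\<close> costs \<open>\<epsilon>\<close>, and flipping one sign of
  \<open>A\<close> shifts the mean of each of the at most \<open>2 * T\<close> observations by \<open>\<epsilon>\<close>, key terms being no more
  informative than arms. If \<open>\<epsilon>\<^sup>2 * T \<le> 1 / 4\<close>, the two laws of the history cannot be told apart, so
  that on average over \<open>A\<close> each coordinate is wrong with probability at least \<open>1 / 4\<close> in each round.
  The norm of the preference vector requires \<open>\<epsilon> \<le> 2 / d\<close>, and the best choice of \<open>\<epsilon>\<close> yields regret
  of order \<open>min T (d * sqrt T)\<close>. This covers both claims, since \<open>ln T \<le> d\<close> for \<open>T = 2 ^ m\<close>, \<open>m \<le> d\<close>.
\<close>

section \<open>A variational form of the chi-square divergence\<close>

text \<open>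
  By duality in \<open>L\<^sup>2(Q)\<close> this says that \<open>1 + \<chi>\<^sup>2(P | Q) \<le> B\<close>. Written without densities, it is
  inherited by composed kernels, where the bounds multiply.
\<close>

definition chi_square_le :: "ennreal \<Rightarrow> 'a measure \<Rightarrow> 'a measure \<Rightarrow> bool" where
  "chi_square_le B P Q \<longleftrightarrow> sets P = sets Q \<and>
     (\<forall>f\<in>borel_measurable Q. (\<integral>\<^sup>+x. f x \<partial>P)\<^sup>2 \<le> B * (\<integral>\<^sup>+x. (f x)\<^sup>2 \<partial>Q))"

text \<open>Cauchy-Schwarz against the constant \<open>1\<close>. This serves the parts of a round
  whose law does not depend on the preference vector, such as the random choices of the
  policy.\<close>

lemma chi_square_le_refl:
  assumes "prob_space P" and B: "1 \<le> B"
  shows "chi_square_le B P P"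
proof -
  interpret prob_space P by fact
  have "(\<integral>\<^sup>+x. f x \<partial>P)\<^sup>2 \<le> B * (\<integral>\<^sup>+x. (f x)\<^sup>2 \<partial>P)"
    if f: "f \<in> borel_measurable P" for f :: "'a \<Rightarrow> ennreal"
  proof -
    have "(\<integral>\<^sup>+x. f x \<partial>P)\<^sup>2 \<le> 1 * (\<integral>\<^sup>+x. (f x)\<^sup>2 \<partial>P)"
      using Cauchy_Schwarz_nn_integral[OF f, of "\<lambda>_. 1"] by (simp add: emeasure_space_1)
    also have "\<dots> \<le> B * (\<integral>\<^sup>+x. (f x)\<^sup>2 \<partial>P)"
      using B by (intro mult_right_mono) auto
    finally show ?thesis .
  qed
  then show ?thesis by (simp add: chi_square_le_def)
qed

lemma chi_square_le_mono:
  assumes "chi_square_le B P Q" and "B \<le> C"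
  shows "chi_square_le C P Q"
  unfolding chi_square_le_def
proof (intro conjI ballI)
  show "sets P = sets Q" using assms(1) by (simp add: chi_square_le_def)
  fix f :: "'a \<Rightarrow> ennreal" assume "f \<in> borel_measurable Q"
  then have "(\<integral>\<^sup>+x. f x \<partial>P)\<^sup>2 \<le> B * (\<integral>\<^sup>+x. (f x)\<^sup>2 \<partial>Q)"
    using assms(1) by (simp add: chi_square_le_def)
  also have "\<dots> \<le> C * (\<integral>\<^sup>+x. (f x)\<^sup>2 \<partial>Q)"
    by (intro mult_right_mono assms(2)) simp
  finally show "(\<integral>\<^sup>+x. f x \<partial>P)\<^sup>2 \<le> C * (\<integral>\<^sup>+x. (f x)\<^sup>2 \<partial>Q)" .
qed

text \<open>Chain rule: the bound for \<open>P\<close> and \<open>Q\<close> is applied to the inner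
  integral \<open>\<psi>\<close>, whose square is then controlled pointwise by the bound for the
  kernels.\<close>

lemma chi_square_le_bind:
  assumes PQ: "chi_square_le B P Q"
    and K: "K \<in> Q \<rightarrow>\<^sub>M subprob_algebra N" and L: "L \<in> Q \<rightarrow>\<^sub>M subprob_algebra N"
    and KL: "\<And>x. x \<in> space Q \<Longrightarrow> chi_square_le C (K x) (L x)"
    and ne: "space Q \<noteq> {}"
  shows "chi_square_le (B * C) (P \<bind> K) (Q \<bind> L)"
proof -
  have sets: "sets P = sets Q" using PQ by (simp add: chi_square_le_def)
  have K': "K \<in> P \<rightarrow>\<^sub>M subprob_algebra N" using K sets by (simp cong: measurable_cong_sets)
  have sP: "sets (P \<bind> K) = sets N"
    by (rule sets_bind_measurable[OF K']) (use ne sets_eq_imp_space_eq[OF sets] in simp)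
  have sQ: "sets (Q \<bind> L) = sets N" by (rule sets_bind_measurable[OF L ne])
  have "(\<integral>\<^sup>+x. f x \<partial>(P \<bind> K))\<^sup>2 \<le> B * C * (\<integral>\<^sup>+x. (f x)\<^sup>2 \<partial>(Q \<bind> L))"
    if "f \<in> borel_measurable (Q \<bind> L)" for f
  proof -
    have f[measurable]: "f \<in> borel_measurable N"
      using that sQ by (simp cong: measurable_cong_sets)
    define \<psi> where "\<psi> x = (\<integral>\<^sup>+y. f y \<partial>K x)" for x
    have \<psi>: "\<psi> \<in> borel_measurable Q"
      unfolding \<psi>_def by (rule measurable_compose[OF K nn_integral_measurable_subprob_algebra[OF f]])
    have m: "(\<lambda>x. \<integral>\<^sup>+y. (f y)\<^sup>2 \<partial>L x) \<in> borel_measurable Q"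
      by (rule measurable_compose[OF L nn_integral_measurable_subprob_algebra]) measurable
    have "(\<integral>\<^sup>+x. f x \<partial>(P \<bind> K))\<^sup>2 = (\<integral>\<^sup>+x. \<psi> x \<partial>P)\<^sup>2"
      unfolding \<psi>_def by (simp add: nn_integral_bind[OF f K'])
    also have "\<dots> \<le> B * (\<integral>\<^sup>+x. (\<psi> x)\<^sup>2 \<partial>Q)"
      using PQ \<psi> by (simp add: chi_square_le_def)
    also have "(\<integral>\<^sup>+x. (\<psi> x)\<^sup>2 \<partial>Q) \<le> (\<integral>\<^sup>+x. C * (\<integral>\<^sup>+y. (f y)\<^sup>2 \<partial>L x) \<partial>Q)"
    proof (rule nn_integral_mono)
      fix x assume x: "x \<in> space Q"
      have "f \<in> borel_measurable (L x)"
        using f sets_kernel[OF L x] by (simp cong: measurable_cong_sets)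
      then show "(\<psi> x)\<^sup>2 \<le> C * (\<integral>\<^sup>+y. (f y)\<^sup>2 \<partial>L x)"
        using KL[OF x] by (simp add: chi_square_le_def \<psi>_def)
    qed
    also have "\<dots> = C * (\<integral>\<^sup>+x. (f x)\<^sup>2 \<partial>(Q \<bind> L))"
      using L by (simp add: nn_integral_cmult[OF m] nn_integral_bind[where B = N])
    finally show ?thesis by (simp add: mult.assoc mult_left_mono)
  qed
  then show ?thesis using sP sQ by (simp add: chi_square_le_def)
qed

text \<open>Data processing: test functions are pulled back along \<open>g\<close>.\<close>

lemma chi_square_le_distr:
  assumes PQ: "chi_square_le B P Q" and g: "g \<in> Q \<rightarrow>\<^sub>M N"
  shows "chi_square_le B (distr P N g) (distr Q N g)"
proof -
  have g': "g \<in> P \<rightarrow>\<^sub>M N"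
    using PQ g by (simp add: chi_square_le_def cong: measurable_cong_sets)
  show ?thesis
    unfolding chi_square_le_def
  proof (intro conjI ballI)
    fix f :: "'b \<Rightarrow> ennreal" assume "f \<in> borel_measurable (distr Q N g)"
    then have f[measurable]: "f \<in> borel_measurable N" by simp
    have "(\<lambda>x. f (g x)) \<in> borel_measurable Q" by (rule measurable_compose[OF g f])
    then have "(\<integral>\<^sup>+x. f (g x) \<partial>P)\<^sup>2 \<le> B * (\<integral>\<^sup>+x. (f (g x))\<^sup>2 \<partial>Q)"
      using PQ by (simp add: chi_square_le_def)
    then show "(\<integral>\<^sup>+x. f x \<partial>distr P N g)\<^sup>2 \<le> B * (\<integral>\<^sup>+x. (f x)\<^sup>2 \<partial>distr Q N g)"
      by (simp add: nn_integral_distr[OF g] nn_integral_distr[OF g'])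
  qed simp
qed

text \<open>Let \<open>p\<close> and \<open>q\<close> be the probabilities of \<open>A\<close> under
  \<open>P\<close> and \<open>Q\<close>. The indicator of \<open>A\<close> as test function gives
  \<open>p^2 \<le> 2 * q\<close>, hence \<open>q + 1 - p \<ge> ((p - 1)^2 + 1) / 2\<close>.\<close>

lemma chi_square_le_testing:
  assumes P: "prob_space P" and Q: "prob_space Q" and PQ: "chi_square_le (ennreal 2) P Q"
    and A: "A \<in> sets Q"
  shows "1 / 2 \<le> measure Q A + measure P (space P - A)"
proof -
  interpret P: prob_space P by fact
  interpret Q: prob_space Q by fact
  have A': "A \<in> sets P" using A PQ by (simp add: chi_square_le_def)
  have ind: "(indicator A x :: ennreal)\<^sup>2 = indicator A x" for x
    by (simp add: indicator_def)
  have "(\<integral>\<^sup>+x. indicator A x \<partial>P)\<^sup>2 \<le> ennreal 2 * (\<integral>\<^sup>+x. (indicator A x)\<^sup>2 \<partial>Q)"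
    using PQ borel_measurable_indicator[OF A] unfolding chi_square_le_def by blast
  then have "(emeasure P A)\<^sup>2 \<le> ennreal 2 * emeasure Q A"
    using A A' by (simp add: ind)
  then have "(measure P A)\<^sup>2 \<le> 2 * measure Q A"
    by (simp add: P.emeasure_eq_measure Q.emeasure_eq_measure ennreal_power
        flip: ennreal_mult ennreal_numeral del: ennreal_numeral)
  moreover have "0 \<le> (measure P A - 1)\<^sup>2" by simp
  ultimately show ?thesis
    using P.prob_compl[OF A'] by (simp add: power2_diff)
qed

section \<open>Normal laws of unit variance\<close>

lemma nn_integral_shifted_std_normal:
  assumes [measurable]: "f \<in> borel_measurable borel"
  shows "(\<integral>\<^sup>+x. f x \<partial>distr std_normal_distribution borel (\<lambda>e. m + e))
    = (\<integral>\<^sup>+x. f x * ennreal (normal_density m 1 x) \<partial>lborel)"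
proof -
  have "(\<integral>\<^sup>+x. f x \<partial>distr std_normal_distribution borel (\<lambda>e. m + e))
      = (\<integral>\<^sup>+x. ennreal (std_normal_density x) * f (m + x) \<partial>lborel)"
    by (subst nn_integral_distr, simp, simp, subst nn_integral_density) auto
  \<comment> \<open>The factor \<open>1\<close> gives the integrand the shape required by the affine
    substitution rule.\<close>
  also have "\<dots> = (\<integral>\<^sup>+x. f (m + 1 * x) * ennreal (normal_density m 1 (m + 1 * x)) \<partial>lborel)"
    by (simp add: normal_density_def mult.commute)
  also have "\<dots> = (\<integral>\<^sup>+x. f x * ennreal (normal_density m 1 x) \<partial>lborel)"
    by (subst (2) nn_integral_real_affine[where c = 1 and t = m]) auto
  finally show ?thesis .
qed

text \<open>The squared density with mean \<open>m\<close>, divided by the density with mean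
  \<open>m'\<close>, is \<open>exp ((m - m')^2)\<close> times another normal density. Cauchy-Schwarz
  along this factorisation leaves just that exponential as the constant.\<close>

lemma chi_square_le_shifted_std_normal:
  assumes "(m - m')\<^sup>2 \<le> s"
  shows "chi_square_le (ennreal (exp s)) (distr std_normal_distribution borel (\<lambda>e. m + e))
    (distr std_normal_distribution borel (\<lambda>e. m' + e))"
proof (rule chi_square_le_mono)
  let ?n = "\<lambda>m x. normal_density m 1 x"
  have sq: "(ennreal (sqrt a))\<^sup>2 = ennreal a" if "0 \<le> a" for a
    using that by (simp add: ennreal_power)
  \<comment> \<open>Completing the square yields the mean \<open>2 * m - m'\<close>, the reflection
    of \<open>m'\<close> in \<open>m\<close>.\<close>
  have fact: "?n m x = sqrt (?n m' x) * sqrt (exp ((m - m')\<^sup>2) * ?n (2 * m - m') x)" for x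
  proof -
    have "(?n m x)\<^sup>2 = ?n m' x * (exp ((m - m')\<^sup>2) * ?n (2 * m - m') x)"
    proof -
      have "exp (- ((x - m)\<^sup>2 / 2)) ^ 2
          = exp (- ((x - m')\<^sup>2 / 2)) * (exp ((m - m')\<^sup>2) * exp (- ((x - (2 * m - m'))\<^sup>2 / 2)))"
        by (simp add: exp_add[symmetric] exp_double[symmetric])
           (simp add: power2_eq_square field_simps)
      then show ?thesis
        by (simp add: normal_density_def power_divide power_mult_distrib power2_eq_square[of "sqrt _"])
    qed
    then show ?thesis
      by (metis normal_density_nonneg real_sqrt_abs real_sqrt_mult abs_of_nonneg)
  qed
  have "(\<integral>\<^sup>+x. f x * ennreal (?n m x) \<partial>lborel)\<^sup>2
      \<le> ennreal (exp ((m - m')\<^sup>2)) * (\<integral>\<^sup>+x. (f x)\<^sup>2 * ennreal (?n m' x) \<partial>lborel)"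
    if [measurable]: "f \<in> borel_measurable borel" for f
  proof -
    have "(\<integral>\<^sup>+x. f x * ennreal (?n m x) \<partial>lborel)\<^sup>2
        = (\<integral>\<^sup>+x. (f x * ennreal (sqrt (?n m' x)))
            * ennreal (sqrt (exp ((m - m')\<^sup>2) * ?n (2 * m - m') x)) \<partial>lborel)\<^sup>2"
      by (subst fact) (simp add: ennreal_mult mult.assoc)
    also have "\<dots> \<le> (\<integral>\<^sup>+x. (f x * ennreal (sqrt (?n m' x)))\<^sup>2 \<partial>lborel)
        * (\<integral>\<^sup>+x. (ennreal (sqrt (exp ((m - m')\<^sup>2) * ?n (2 * m - m') x)))\<^sup>2 \<partial>lborel)"
      by (rule Cauchy_Schwarz_nn_integral) auto
    also have "\<dots> = (\<integral>\<^sup>+x. (f x)\<^sup>2 * ennreal (?n m' x) \<partial>lborel)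
        * (\<integral>\<^sup>+x. ennreal (exp ((m - m')\<^sup>2)) * ennreal (?n (2 * m - m') x) \<partial>lborel)"
      by (simp add: power_mult_distrib sq ennreal_mult)
    also have "\<dots> = (\<integral>\<^sup>+x. (f x)\<^sup>2 * ennreal (?n m' x) \<partial>lborel) * ennreal (exp ((m - m')\<^sup>2))"
      by (simp add: nn_integral_cmult nn_integral_eq_integral)
    finally show ?thesis by (simp add: mult.commute)
  qed
  then show "chi_square_le (ennreal (exp ((m - m')\<^sup>2)))
      (distr std_normal_distribution borel (\<lambda>e. m + e))
      (distr std_normal_distribution borel (\<lambda>e. m' + e))"
    by (simp add: chi_square_le_def nn_integral_shifted_std_normal)
qed (use assms in simp)

text \<open>Exponential tilting by \<open>l\<close> turns the density into
  \<open>exp (l^2 / 2)\<close> times the normal density with mean \<open>l\<close>, so the bound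
  holds with equality.\<close>

lemma sub_gaussian_std_normal: "sub_gaussian 1 std_normal_distribution"
proof -
  have e: "std_normal_density x * exp (l * x) = exp (l\<^sup>2 / 2) * normal_density l 1 x" for l x :: real
  proof -
    have "exp (- (x\<^sup>2 / 2)) * exp (l * x) = exp (l\<^sup>2 / 2) * exp (- ((x - l)\<^sup>2 / 2))"
      by (simp add: exp_add[symmetric] power2_eq_square field_simps)
    then show ?thesis by (simp add: normal_density_def)
  qed
  show ?thesis
    unfolding sub_gaussian_def
    by (simp add: integrable_density integral_density e)
qed

section \<open>The hypercube instances\<close>

definition sign_vec :: "real \<Rightarrow> nat set \<Rightarrow> nat \<Rightarrow> real" where
  "sign_vec c A = (\<lambda>i. if i \<in> A then c else - c)"

text \<open>A label codes in binary the set of coordinates with positive sign. Label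
  \<open>0\<close> codes the empty set, so the key term has all signs negative. Every arm is offered
  in every round.\<close>

definition cube_setting :: "nat \<Rightarrow> bandit_setting" where
  "cube_setting d =
    \<lparr>arms = {a. set_decode a \<subseteq> {..<d}},
     arm_vec = (\<lambda>a. sign_vec (1 / sqrt (real d)) (set_decode a)),
     arm_sets = (\<lambda>_. {a. set_decode a \<subseteq> {..<d}}),
     key_terms = {0},
     key_vec = (\<lambda>k. sign_vec (1 / sqrt (real d)) (set_decode k))\<rparr>"

text \<open>The scaling of the preference vector is such that flipping one of its signs changes every
  expected reward and every expected feedback by exactly \<open>\<epsilon>\<close> in absolute value.\<close>

definition cube_instance :: "nat \<Rightarrow> real \<Rightarrow> nat set \<Rightarrow> bandit_instance" where
  "cube_instance d \<epsilon> A =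
    \<lparr>setting = cube_setting d,
     theta = sign_vec (\<epsilon> * sqrt (real d) / 2) A,
     key_noise = (\<lambda>t h k. std_normal_distribution),
     arm_noise = (\<lambda>t h k a. std_normal_distribution)\<rparr>"

lemma L2_set_sign_vec: "L2_set (sign_vec c A) {..<d} = sqrt (real d) * \<bar>c\<bar>"
proof -
  have "(\<Sum>i<d. (sign_vec c A i)\<^sup>2) = real d * c\<^sup>2"
    by (simp add: sign_vec_def if_distrib[of "\<lambda>x. x\<^sup>2"] cong: if_cong)
  then show ?thesis by (simp add: L2_set_def real_sqrt_mult)
qed

text \<open>The factors \<open>sqrt (real d)\<close> cancel, so each agreeing sign contributes
  \<open>\<epsilon> / 2\<close> and each disagreeing one \<open>- \<epsilon> / 2\<close>. Regret and
  flips can then be computed coordinate by coordinate.\<close>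

lemma inner_sign_vec:
  assumes "d \<ge> 1"
  shows "inner_dim d (sign_vec (1 / sqrt (real d)) X) (sign_vec (\<epsilon> * sqrt (real d) / 2) A)
    = (\<Sum>i<d. sign_vec (\<epsilon> / 2) {i. i \<in> X \<longleftrightarrow> i \<in> A} i)"
  unfolding inner_dim_def using assms by (intro sum.cong) (auto simp: sign_vec_def)

lemma finite_decode_subset: "finite {a. set_decode a \<subseteq> {..<d}}"
proof -
  have "{a. set_decode a \<subseteq> {..<d}} \<subseteq> set_encode ` Pow {..<d}"
  proof
    fix a assume "a \<in> {a. set_decode a \<subseteq> {..<d}}"
    then have "set_decode a \<in> Pow {..<d}" by simp
    then have "set_encode (set_decode a) \<in> set_encode ` Pow {..<d}" by (rule imageI)
    then show "a \<in> set_encode ` Pow {..<d}" by simp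
  qed
  then show ?thesis by (rule finite_subset) simp
qed

lemma cube_setting_valid:
  assumes "d \<ge> 1"
  shows "bandit_setting_valid d T (cube_setting d)"
proof -
  have "set_decode 0 \<subseteq> {..<d}" by simp
  then have "{a. set_decode a \<subseteq> {..<d}} \<noteq> {}" by blast
  then show ?thesis
    using assms
    by (simp add: bandit_setting_valid_def cube_setting_def L2_set_sign_vec finite_decode_subset)
qed

lemma std_normal_in_prob_algebra: "std_normal_distribution \<in> space (prob_algebra borel)"
  by (simp add: space_prob_algebra prob_space_normal_density)

lemma cube_instance_valid:
  assumes "d \<ge> 1" and "0 \<le> \<epsilon>" and "\<epsilon> * real d \<le> 2"
  shows "bandit_instance_valid d T (cube_instance d \<epsilon> A)"
proof -
  \<comment> \<open>The norm is \<open>\<epsilon> * real d / 2\<close>, which explains the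
    assumption \<open>\<epsilon> * real d \<le> 2\<close>.\<close>
  have "L2_set (sign_vec (\<epsilon> * sqrt (real d) / 2) A) {..<d} = \<epsilon> * (sqrt (real d) * sqrt (real d)) / 2"
    using assms(2) by (simp add: L2_set_sign_vec abs_mult del: real_sqrt_mult_self)
  also have "\<dots> \<le> 1" using assms(3) by simp
  finally show ?thesis
    using assms(1) std_normal_in_prob_algebra sub_gaussian_std_normal
    by (simp add: bandit_instance_valid_def cube_instance_def cube_setting_valid)
qed

text \<open>Since every sign pattern is offered, the best arm copies \<open>A\<close> and agrees in
  all coordinates. A wrong coordinate then loses
  \<open>\<epsilon> / 2 - (- \<epsilon> / 2)\<close>.\<close>

lemma regret_cube:
  assumes "d \<ge> 1" and "0 \<le> \<epsilon>" and A: "A \<subseteq> {..<d}"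
  shows "regret d T (cube_instance d \<epsilon> A) h = (\<Sum>t<T. \<Sum>i<d.
    \<epsilon> * of_bool ((i \<in> set_decode (selected_arm (h t))) \<noteq> (i \<in> A)))"
proof -
  let ?v = "\<lambda>a. \<Sum>i<d. sign_vec (\<epsilon> / 2) {i. i \<in> set_decode a \<longleftrightarrow> i \<in> A} i"
  have fin: "finite A" using A finite_subset by blast
  have "?v a \<le> (\<Sum>i<d. \<epsilon> / 2)" for a
    using \<open>0 \<le> \<epsilon>\<close> by (intro sum_mono) (simp add: sign_vec_def)
  moreover have "?v (set_encode A) = (\<Sum>i<d. \<epsilon> / 2)"
    using fin by (simp add: sign_vec_def)
  ultimately have "Max (?v ` {a. set_decode a \<subseteq> {..<d}}) = (\<Sum>i<d. \<epsilon> / 2)"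
    using A fin finite_decode_subset
    by (intro Max_eqI) (auto intro!: image_eqI[where x = "set_encode A"])
  moreover have "(\<Sum>i<d. \<epsilon> / 2) - ?v a = (\<Sum>i<d. \<epsilon> * of_bool ((i \<in> set_decode a) \<noteq> (i \<in> A)))" for a
    unfolding sum_subtractf[symmetric] by (intro sum.cong) (auto simp: sign_vec_def)
  ultimately show ?thesis
    unfolding regret_def cube_instance_def cube_setting_def
    by (simp only: bandit_instance.simps bandit_setting.simps inner_sign_vec[OF assms(1)])
qed

section \<open>Indistinguishability of neighbouring instances\<close>

lemma chi_square_le_shifted_flip:
  assumes "d \<ge> 1" and sd: "sym_diff A B = {i}"
  shows "chi_square_le (ennreal (exp (\<epsilon>\<^sup>2)))
    (distr std_normal_distribution borel (\<lambda>e. inner_dim d (sign_vec (1 / sqrt (real d)) X)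
        (sign_vec (\<epsilon> * sqrt (real d) / 2) A) + e))
    (distr std_normal_distribution borel (\<lambda>e. inner_dim d (sign_vec (1 / sqrt (real d)) X)
        (sign_vec (\<epsilon> * sqrt (real d) / 2) B) + e))"
proof (rule chi_square_le_shifted_std_normal)
  have "(\<Sum>j<d. sign_vec (\<epsilon> / 2) {j. j \<in> X \<longleftrightarrow> j \<in> A} j) -
      (\<Sum>j<d. sign_vec (\<epsilon> / 2) {j. j \<in> X \<longleftrightarrow> j \<in> B} j)
    = (\<Sum>j<d. if j = i then (if i \<in> X \<longleftrightarrow> i \<in> A then \<epsilon> else - \<epsilon>) else 0)"
    unfolding sum_subtractf[symmetric] using sd
    by (intro sum.cong) (auto simp: sign_vec_def)
  \<comment> \<open>The sum is \<open>\<epsilon>\<close> or \<open>- \<epsilon>\<close> if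
    \<open>i < d\<close>, and \<open>0\<close> otherwise.\<close>
  also have "\<dots>\<^sup>2 \<le> \<epsilon>\<^sup>2" by (simp add: sum.delta)
  finally show "(inner_dim d (sign_vec (1 / sqrt (real d)) X)
        (sign_vec (\<epsilon> * sqrt (real d) / 2) A) -
      inner_dim d (sign_vec (1 / sqrt (real d)) X)
        (sign_vec (\<epsilon> * sqrt (real d) / 2) B))\<^sup>2 \<le> \<epsilon>\<^sup>2"
    by (simp add: inner_sign_vec[OF assms(1)])
qed

lemma space_round_space [simp]: "space round_space = UNIV"
  by (simp add: round_space_def space_pair_measure)

text \<open>The feedback and the reward each contribute a factor \<open>exp (\<epsilon>^2)\<close>;
  the two choices of the policy contribute \<open>1\<close>.\<close>

lemma chi_square_le_round_law:
  assumes d: "d \<ge> 1" and sd: "sym_diff A B = {i}"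
    and \<pi>: "bandit_policy_valid d T \<pi>" and h: "h \<in> space (history_space t)"
  shows "chi_square_le (ennreal (exp (2 * \<epsilon>\<^sup>2)))
    (round_law d \<pi> (cube_instance d \<epsilon> A) t h) (round_law d \<pi> (cube_instance d \<epsilon> B) t h)"
proof -
  let ?S = "cube_setting d"
  let ?I = "cube_instance d \<epsilon>"
  have S: "bandit_setting_valid d T ?S" by (rule cube_setting_valid[OF d])
  \<comment> \<open>Both instances show the policy the same setting, so given the same past its
    rules draw from the same laws.\<close>
  have set: "setting (?I X) = ?S" for X by (simp add: cube_instance_def)
  have "(\<lambda>(h, y). measure_pmf (arm_rule \<pi> ?S t h k y))
      \<in> history_space t \<Otimes>\<^sub>M borel \<rightarrow>\<^sub>M prob_algebra (count_space UNIV)" for k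
    using \<pi> S by (simp add: bandit_policy_valid_def)
  from measurable_compose[OF measurable_Pair1'[OF h] this]
  have arm: "(\<lambda>y. measure_pmf (arm_rule \<pi> ?S t h k y))
      \<in> borel \<rightarrow>\<^sub>M prob_algebra (count_space UNIV)" for k
    by simp
  have fb: "feedback_law d (?I X) t h k \<in> space (prob_algebra borel)" for X k
    using std_normal_in_prob_algebra
    by (cases k) (auto simp: space_prob_algebra cube_instance_def prob_space_return
        intro!: prob_space.prob_space_distr)
  have rw: "reward_law d (?I X) t h k a \<in> space (prob_algebra borel)" for X k a
    using std_normal_in_prob_algebra
    by (auto simp: space_prob_algebra cube_instance_def reward_law_def
        intro!: prob_space.prob_space_distr)
  have "(\<lambda>z. (k, fst z, a, snd z)) \<in> borel \<Otimes>\<^sub>M borel \<rightarrow>\<^sub>M round_space" for k a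
    unfolding round_space_def by measurable
  from measurable_compose[OF this measurable_return_prob_space]
  have ret: "(\<lambda>(y, r). return round_space (k, y, a, r)) \<in> borel \<Otimes>\<^sub>M borel \<rightarrow>\<^sub>M prob_algebra round_space"
    for k a by (simp add: case_prod_beta')
  have ret': "(\<lambda>r. return round_space (k, y, a, r)) \<in> borel \<rightarrow>\<^sub>M prob_algebra round_space" for k y a
    using measurable_compose[OF measurable_Pair1' ret, of y] by simp
  have k1: "(\<lambda>y. reward_law d (?I X) t h k a \<bind> (\<lambda>r. return round_space (k, y, a, r)))
      \<in> borel \<rightarrow>\<^sub>M prob_algebra round_space" for X k a
    by (rule measurable_bind_prob_space2[OF _ ret]) (simp add: rw)
  have k2: "(\<lambda>y. measure_pmf (arm_rule \<pi> ?S t h k y) \<bind> (\<lambda>a.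
      reward_law d (?I X) t h k a \<bind> (\<lambda>r. return round_space (k, y, a, r))))
      \<in> borel \<rightarrow>\<^sub>M prob_algebra round_space" for X k
    by (rule measurable_bind_countable_prob_space[OF arm k1])
  have k3: "feedback_law d (?I X) t h k \<bind> (\<lambda>y. measure_pmf (arm_rule \<pi> ?S t h k y) \<bind> (\<lambda>a.
      reward_law d (?I X) t h k a \<bind> (\<lambda>r. return round_space (k, y, a, r))))
      \<in> space (prob_algebra round_space)" for X k
    using prob_space_bind'[OF fb k2] sets_bind'[OF fb k2] by (simp add: space_prob_algebra)
  have sub: "space (prob_algebra N) \<subseteq> space (subprob_algebra N)" for N :: "round measure"
    by (auto simp: space_prob_algebra space_subprob_algebra prob_space_imp_subprob_space)
  have c_fb: "chi_square_le (ennreal (exp (\<epsilon>\<^sup>2))) (feedback_law d (?I A) t h k)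
      (feedback_law d (?I B) t h k)" for k
  proof (cases k)
    \<comment> \<open>Without a key term the feedback is the point mass at \<open>0\<close> under
      both instances.\<close>
    case None
    then show ?thesis
      by (simp add: chi_square_le_refl prob_space_return)
  next
    case (Some j)
    then show ?thesis
      using chi_square_le_shifted_flip[OF d sd] by (simp add: cube_instance_def cube_setting_def)
  qed
  have c_rw: "chi_square_le (ennreal (exp (\<epsilon>\<^sup>2))) (reward_law d (?I A) t h k a)
      (reward_law d (?I B) t h k a)" for k a
    using chi_square_le_shifted_flip[OF d sd]
    by (simp add: reward_law_def cube_instance_def cube_setting_def)
  have sp: "space (feedback_law d (?I X) t h k) = UNIV" "space (reward_law d (?I X) t h k a) = UNIV"
    for X k a
    using fb[of X k] rw[of X k a] by (auto simp: space_prob_algebra dest!: sets_eq_imp_space_eq)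
  have sets: "sets (feedback_law d (?I X) t h k) = sets borel"
    "sets (reward_law d (?I X) t h k a) = sets borel" for X k a
    using fb[of X k] rw[of X k a] by (auto simp: space_prob_algebra)
  \<comment> \<open>The round is assembled from the inside out: reward, arm, feedback, key term.
    Each layer multiplies the constant by its own factor.\<close>
  have c1: "chi_square_le (ennreal (exp (\<epsilon>\<^sup>2)) * 1)
      (reward_law d (?I A) t h k a \<bind> (\<lambda>r. return round_space (k, y, a, r)))
      (reward_law d (?I B) t h k a \<bind> (\<lambda>r. return round_space (k, y, a, r)))" for k y a
    using measurable_prob_algebraD[OF ret'] sets
    by (intro chi_square_le_bind[OF c_rw, where N = round_space] chi_square_le_refl
        prob_space_return)
      (auto simp: sp cong: measurable_cong_sets)
  have c2: "chi_square_le (1 * (ennreal (exp (\<epsilon>\<^sup>2)) * 1))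
      (measure_pmf (arm_rule \<pi> ?S t h k y) \<bind> (\<lambda>a.
        reward_law d (?I A) t h k a \<bind> (\<lambda>r. return round_space (k, y, a, r))))
      (measure_pmf (arm_rule \<pi> ?S t h k y) \<bind> (\<lambda>a.
        reward_law d (?I B) t h k a \<bind> (\<lambda>r. return round_space (k, y, a, r))))" for k y
    using subsetD[OF sub measurable_space[OF k1]]
    by (intro chi_square_le_bind[OF chi_square_le_refl[OF measure_pmf.prob_space_axioms order_refl]
        _ _ c1]) auto
  have c3: "chi_square_le (ennreal (exp (\<epsilon>\<^sup>2)) * (1 * (ennreal (exp (\<epsilon>\<^sup>2)) * 1)))
      (feedback_law d (?I A) t h k \<bind> (\<lambda>y. measure_pmf (arm_rule \<pi> ?S t h k y) \<bind> (\<lambda>a.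
        reward_law d (?I A) t h k a \<bind> (\<lambda>r. return round_space (k, y, a, r)))))
      (feedback_law d (?I B) t h k \<bind> (\<lambda>y. measure_pmf (arm_rule \<pi> ?S t h k y) \<bind> (\<lambda>a.
        reward_law d (?I B) t h k a \<bind> (\<lambda>r. return round_space (k, y, a, r)))))" for k
    using measurable_prob_algebraD[OF k2] sets
    by (intro chi_square_le_bind[OF c_fb _ _ c2]) (auto simp: sp cong: measurable_cong_sets)
  have "chi_square_le (1 * (ennreal (exp (\<epsilon>\<^sup>2)) * (1 * (ennreal (exp (\<epsilon>\<^sup>2)) * 1))))
      (round_law d \<pi> (?I A) t h) (round_law d \<pi> (?I B) t h)"
    unfolding round_law_def set
    using subsetD[OF sub k3]
    by (intro chi_square_le_bind[OF chi_square_le_refl[OF measure_pmf.prob_space_axioms order_refl]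
        _ _ c3]) auto
  then show ?thesis by (simp add: ennreal_mult[symmetric] exp_add[symmetric])
qed

text \<open>Induction over the rounds: each new round multiplies the constant by
  \<open>exp (2 * \<epsilon>^2)\<close>, uniformly in the past.\<close>

lemma chi_square_le_history_law:
  assumes d: "d \<ge> 1" and \<epsilon>: "0 \<le> \<epsilon>" "\<epsilon> * real d \<le> 2" and sd: "sym_diff A B = {i}"
    and \<pi>: "bandit_policy_valid d T \<pi>"
  shows "chi_square_le (ennreal (exp (2 * \<epsilon>\<^sup>2 * real n)))
    (history_law d n \<pi> (cube_instance d \<epsilon> A)) (history_law d n \<pi> (cube_instance d \<epsilon> B))"
proof (induction n)
  interpret IA: Ionescu_Tulcea "round_law d \<pi> (cube_instance d \<epsilon> A)" "\<lambda>_. round_space"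
    by (rule Ionescu_Tulcea_round_law[OF cube_instance_valid[OF d \<epsilon>] \<pi>])
  interpret IB: Ionescu_Tulcea "round_law d \<pi> (cube_instance d \<epsilon> B)" "\<lambda>_. round_space"
    by (rule Ionescu_Tulcea_round_law[OF cube_instance_valid[OF d \<epsilon>] \<pi>])
  {
    \<comment> \<open>Both laws are the point mass at the empty history.\<close>
    case 0
    show ?case
      by (simp add: history_law_def chi_square_le_refl prob_space_return space_PiM PiE_iff
          extensional_def)
  next
    case (Suc n)
    have u: "(\<lambda>_. undefined) \<in> space (PiM {0..<0} (\<lambda>_. round_space))" by (simp add: space_PiM PiE_iff extensional_def)
    have sets: "sets (history_law d n \<pi> (cube_instance d \<epsilon> B)) = sets (history_space n)"
      using IB.sets_C[OF u, of n] by (simp add: history_law_def history_space_def)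
    have sp: "space (history_law d n \<pi> (cube_instance d \<epsilon> B)) = space (history_space n)"
      by (rule sets_eq_imp_space_eq[OF sets])
    have "chi_square_le (ennreal (exp (2 * \<epsilon>\<^sup>2 * real n)) * ennreal (exp (2 * \<epsilon>\<^sup>2)))
        (history_law d n \<pi> (cube_instance d \<epsilon> A) \<bind> IA.eP n)
        (history_law d n \<pi> (cube_instance d \<epsilon> B) \<bind> IB.eP n)"
    proof (rule chi_square_le_bind[OF Suc.IH])
      show "IA.eP n \<in> history_law d n \<pi> (cube_instance d \<epsilon> B) \<rightarrow>\<^sub>M
          subprob_algebra (PiM {0..<Suc n} (\<lambda>_. round_space))"
        using IA.measurable_eP[of n] sets
        by (simp add: history_space_def cong: measurable_cong_sets)
      show "IB.eP n \<in> history_law d n \<pi> (cube_instance d \<epsilon> B) \<rightarrow>\<^sub>M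
          subprob_algebra (PiM {0..<Suc n} (\<lambda>_. round_space))"
        using IB.measurable_eP[of n] sets
        by (simp add: history_space_def cong: measurable_cong_sets)
      show "space (history_law d n \<pi> (cube_instance d \<epsilon> B)) \<noteq> {}"
        using prob_space.not_empty[OF IB.prob_space_C[OF u, of n]] by (simp add: history_law_def)
      fix h assume "h \<in> space (history_law d n \<pi> (cube_instance d \<epsilon> B))"
      then have h: "h \<in> space (history_space n)" by (simp add: sp)
      then have h': "h \<in> space (PiM {0..<n} (\<lambda>_. round_space))" by (simp add: history_space_def)
      \<comment> \<open>The kernel \<open>eP n h\<close> is the image of the round law under
        appending the new round at position \<open>n\<close>, so data processing applies.\<close>
      have "fun_upd h n \<in> round_space \<rightarrow>\<^sub>M PiM {0..<Suc n} (\<lambda>_. round_space)"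
        using h' by (intro measurable_fun_upd[where J = "{0..<n}"]) auto
      then have "fun_upd h n \<in> round_law d \<pi> (cube_instance d \<epsilon> B) n h
          \<rightarrow>\<^sub>M PiM {0..<Suc n} (\<lambda>_. round_space)"
        using IB.sets_P[OF h'] by (simp cong: measurable_cong_sets)
      then show "chi_square_le (ennreal (exp (2 * \<epsilon>\<^sup>2))) (IA.eP n h) (IB.eP n h)"
        unfolding IA.eP_def IB.eP_def
        by (intro chi_square_le_distr chi_square_le_round_law[OF d sd \<pi> h])
    qed
    then show ?case
      by (simp add: history_law_def ennreal_mult[symmetric] exp_add[symmetric] algebra_simps)
  }
qed


section \<open>The lower bound\<close>

text \<open>Assouad's argument: pairing each \<open>A\<close> with its flip at \<open>i\<close>
  gives an average error probability of at least \<open>1 / 4\<close> for every round and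
  coordinate. Some \<open>A\<close> does at least as badly as the average.\<close>

lemma exists_cube_regret_ge:
  assumes d: "d \<ge> 1" and \<epsilon>: "0 \<le> \<epsilon>" "\<epsilon> * real d \<le> 2" and T: "4 * \<epsilon>\<^sup>2 * real T \<le> 1"
    and \<pi>: "bandit_policy_valid d T \<pi>"
  shows "\<exists>A. expected_regret d T \<pi> (cube_instance d \<epsilon> A) \<ge> \<epsilon> * real T * real d / 4"
proof -
  define P where "P A = history_law d T \<pi> (cube_instance d \<epsilon> A)" for A
  \<comment> \<open>The events live on the full history of \<open>T\<close> rounds, so that one
    divergence bound serves every round \<open>t\<close>.\<close>
  define E where "E t i = {h \<in> space (history_space T). i \<in> set_decode (selected_arm (h t))}" for t i
  \<comment> \<open>The probability that in round \<open>t\<close> the sign at \<open>i\<close> is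
    wrong for \<open>A\<close>.\<close>
  define W where "W A t i = measure (P A) (if i \<in> A then space (history_space T) - E t i else E t i)"
    for A t i
  have PS: "prob_space (P A)" and sets: "sets (P A) = sets (history_space T)" for A
  proof -
    interpret IA: Ionescu_Tulcea "round_law d \<pi> (cube_instance d \<epsilon> A)" "\<lambda>_. round_space"
      by (rule Ionescu_Tulcea_round_law[OF cube_instance_valid[OF d \<epsilon>] \<pi>])
    have u: "(\<lambda>_. undefined) \<in> space (PiM {0..<0} (\<lambda>_. round_space))"
      by (simp add: space_PiM PiE_iff extensional_def)
    show "prob_space (P A)" "sets (P A) = sets (history_space T)"
      using IA.prob_space_C[OF u, of T] IA.sets_C[OF u, of T]
      by (simp_all add: P_def history_law_def history_space_def)
  qed
  have space: "space (P A) = space (history_space T)" for A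
    by (rule sets_eq_imp_space_eq[OF sets])
  have arm: "selected_arm \<in> round_space \<rightarrow>\<^sub>M count_space UNIV"
    unfolding selected_arm_def round_space_def by measurable
  have E: "E t i \<in> sets (history_space T)" if "t < T" for t i
  proof -
    have "(\<lambda>h. h t) \<in> history_space T \<rightarrow>\<^sub>M round_space"
      unfolding history_space_def using that
      by (intro measurable_component_singleton) simp
    from measurable_compose[OF measurable_compose[OF this arm],
        of "\<lambda>a. i \<in> set_decode a" "count_space UNIV"]
    show ?thesis unfolding E_def by simp
  qed
  have regret: "expected_regret d T \<pi> (cube_instance d \<epsilon> A) = (\<Sum>t<T. \<Sum>i<d. \<epsilon> * W A t i)"
    if A: "A \<subseteq> {..<d}" for A
  proof -
    interpret prob_space "P A" by (rule PS)
    let ?D = "\<lambda>t i. if i \<in> A then space (history_space T) - E t i else E t i"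
    have D: "?D t i \<in> events" if "t < T" for t i
      using E[OF that] by (auto simp: sets space)
    have int: "integrable (P A) (\<lambda>h. \<epsilon> * indicator (?D t i) h)" if "t < T" for t i
      using D[OF that] by (intro integrable_mult_right integrable_real_indicator)
        (simp_all add: emeasure_eq_measure del: if_split)
    have "expected_regret d T \<pi> (cube_instance d \<epsilon> A)
        = (\<integral>h. (\<Sum>t<T. \<Sum>i<d. \<epsilon> * indicator (?D t i) h) \<partial>P A)"
      unfolding expected_regret_def P_def[symmetric] regret_cube[OF d \<epsilon>(1) A]
      by (intro Bochner_Integration.integral_cong refl sum.cong)
        (auto simp: E_def space indicator_def)
    also have "\<dots> = (\<Sum>t<T. \<integral>h. (\<Sum>i<d. \<epsilon> * indicator (?D t i) h) \<partial>P A)"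
      by (intro Bochner_Integration.integral_sum Bochner_Integration.integrable_sum int) simp
    also have "\<dots> = (\<Sum>t<T. \<Sum>i<d. \<integral>h. \<epsilon> * indicator (?D t i) h \<partial>P A)"
      by (intro sum.cong refl Bochner_Integration.integral_sum int) simp
    also have "\<dots> = (\<Sum>t<T. \<Sum>i<d. \<epsilon> * W A t i)"
      using D by (intro sum.cong refl) (simp add: W_def del: if_split)
    finally show ?thesis .
  qed
  have flip: "1 / 2 \<le> W A t i + W (sym_diff A {i}) t i" if t: "t < T" for A t i
  proof -
    let ?B = "sym_diff A {i}"
    \<comment> \<open>The assumption on \<open>T\<close> bounds the exponent by
      \<open>1 / 2\<close>, and \<open>exp (1 / 2) \<le> 2\<close> supplies the constant of the
      testing lemma.\<close>
    have "exp (2 * \<epsilon>\<^sup>2 * real T) \<le> exp (1 / 2)" using T by simp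
    also have "\<dots> \<le> (2::real)" by (rule exp_half_le2)
    finally have le: "ennreal (exp (2 * \<epsilon>\<^sup>2 * real T)) \<le> ennreal 2" by (rule ennreal_leI)
    have AB: "chi_square_le (ennreal 2) (P X) (P Y)" if "sym_diff X Y = {i}" for X Y
      unfolding P_def by (rule chi_square_le_mono[OF chi_square_le_history_law[OF d \<epsilon> that \<pi>] le])
    show ?thesis
    \<comment> \<open>In the testing lemma, \<open>P\<close> is the law of whichever of the two sets
      contains \<open>i\<close>, since its error event is the complement of
      \<open>E t i\<close>.\<close>
    proof (cases "i \<in> A")
      case True
      then have "1 / 2 \<le> measure (P ?B) (E t i) + measure (P A) (space (P A) - E t i)"
        using E[OF t] by (intro chi_square_le_testing PS AB) (auto simp: sets)
      then show ?thesis using True by (simp add: W_def space)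
    next
      case False
      then have "1 / 2 \<le> measure (P A) (E t i) + measure (P ?B) (space (P ?B) - E t i)"
        using E[OF t] by (intro chi_square_le_testing PS AB) (auto simp: sets)
      then show ?thesis using False by (simp add: W_def space)
    qed
  qed
  let ?Q = "Pow {..<d}"
  have avg: "real (card ?Q) / 4 \<le> (\<Sum>A\<in>?Q. W A t i)" if "t < T" "i < d" for t i
  proof -
    \<comment> \<open>Flipping at \<open>i < d\<close> is an involution of the cube, so both halves
      of the pair sum have the same total.\<close>
    have "(\<Sum>A\<in>?Q. W (sym_diff A {i}) t i) = (\<Sum>A\<in>?Q. W A t i)"
      using that(2)
      by (intro sum.reindex_bij_witness[where i = "\<lambda>A. sym_diff A {i}" and j = "\<lambda>A. sym_diff A {i}"])
        auto
    moreover have "(\<Sum>A\<in>?Q. 1 / 2) \<le> (\<Sum>A\<in>?Q. W A t i + W (sym_diff A {i}) t i)"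
      by (intro sum_mono flip that(1))
    ultimately show ?thesis by (simp add: sum.distrib)
  qed
  have "(\<Sum>A\<in>?Q. \<epsilon> * real T * real d / 4) = (\<Sum>t<T. \<Sum>i<d. \<epsilon> * (real (card ?Q) / 4))"
    by simp
  also have "\<dots> \<le> (\<Sum>t<T. \<Sum>i<d. \<epsilon> * (\<Sum>A\<in>?Q. W A t i))"
    using \<epsilon>(1) avg by (intro sum_mono mult_left_mono) auto
  also have "\<dots> = (\<Sum>t<T. \<Sum>A\<in>?Q. \<Sum>i<d. \<epsilon> * W A t i)"
    unfolding sum_distrib_left by (intro sum.cong refl sum.swap)
  also have "\<dots> = (\<Sum>A\<in>?Q. \<Sum>t<T. \<Sum>i<d. \<epsilon> * W A t i)"
    by (rule sum.swap)
  also have "\<dots> = (\<Sum>A\<in>?Q. expected_regret d T \<pi> (cube_instance d \<epsilon> A))"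
    using regret by (intro sum.cong) auto
  finally have sum: "(\<Sum>A\<in>?Q. \<epsilon> * real T * real d / 4)
    \<le> (\<Sum>A\<in>?Q. expected_regret d T \<pi> (cube_instance d \<epsilon> A))" .
  show ?thesis
  proof (rule ccontr)
    assume "\<not> ?thesis"
    then have "(\<Sum>A\<in>?Q. expected_regret d T \<pi> (cube_instance d \<epsilon> A))
        < (\<Sum>A\<in>?Q. \<epsilon> * real T * real d / 4)"
      by (intro sum_strict_mono) (auto simp: not_le)
    with sum show False by simp
  qed
qed

section \<open>Choice of the scale and the two rates\<close>

lemma regret_lower_bound:
  assumes d: "d \<ge> 1" and T: "T \<ge> 1" and \<pi>: "bandit_policy_valid d T \<pi>"
  shows "\<exists>I. bandit_instance_valid d T I \<and>
    expected_regret d T \<pi> I \<ge> 1 / 8 * min (real T) (real d * sqrt (real T))"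
proof -
  \<comment> \<open>The largest scale allowed by both constraints: indistinguishability over
    \<open>T\<close> rounds and the unit ball.\<close>
  define \<epsilon> where "\<epsilon> = min (1 / (2 * sqrt (real T))) (2 / real d)"
  have \<epsilon>: "0 \<le> \<epsilon>" "\<epsilon> * real d \<le> 2"
    using d by (auto simp: \<epsilon>_def min_def field_simps)
  have "\<epsilon>\<^sup>2 \<le> (1 / (2 * sqrt (real T)))\<^sup>2"
    using \<epsilon>(1) by (intro power_mono) (simp_all add: \<epsilon>_def)
  also have "\<dots> = 1 / (4 * real T)" by (simp add: power_divide power_mult_distrib)
  finally have "4 * \<epsilon>\<^sup>2 * real T \<le> 1" using T by (simp add: field_simps)
  then obtain A where A: "\<epsilon> * real T * real d / 4 \<le> expected_regret d T \<pi> (cube_instance d \<epsilon> A)"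
    using exists_cube_regret_ge[OF d \<epsilon> _ \<pi>] by blast
  \<comment> \<open>If indistinguishability limits the scale, the bound equals
    \<open>real d * sqrt (real T) / 8\<close>; if the norm does, it equals
    \<open>real T / 2\<close>.\<close>
  have "1 / 8 * min (real T) (real d * sqrt (real T)) \<le> \<epsilon> * real T * real d / 4"
  proof (cases "1 / (2 * sqrt (real T)) \<le> 2 / real d")
    case True
    have "real T = sqrt (real T) * sqrt (real T)" by simp
    then have "\<epsilon> * real T * real d / 4 = 1 / 8 * (real d * sqrt (real T))"
      using True T by (simp add: \<epsilon>_def min_def field_simps)
    then show ?thesis by (metis min.cobounded2 mult_left_mono zero_le_divide_1_iff zero_le_numeral)
  next
    case False
    then have "\<epsilon> * real T * real d / 4 = real T / 2"
      using d by (simp add: \<epsilon>_def min_def)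
    moreover have "min (real T) (real d * sqrt (real T)) \<le> real T" by simp
    ultimately show ?thesis by linarith
  qed
  with A show ?thesis
    using cube_instance_valid[OF d \<epsilon>, of T A] by (blast intro: order_trans)
qed

theorem theorem4p4:
  shows "\<exists>c::real. c > 0 \<and> (\<forall>d::nat. d \<ge> 1 \<longrightarrow>
    (\<forall>T::nat. T \<ge> 1 \<longrightarrow> (\<forall>\<pi>. bandit_policy_valid d T \<pi> \<longrightarrow>
      (\<exists>I. bandit_instance_valid d T I \<and>
        expected_regret d T \<pi> I \<ge> c * min (real T) (sqrt (real d * real T))))) \<and>
    (\<forall>m\<in>{1..d}. \<forall>T::nat. T = 2 ^ m \<longrightarrow> (\<forall>\<pi>. bandit_policy_valid d T \<pi> \<longrightarrow>
      (\<exists>I. bandit_instance_valid d T I \<and>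
        expected_regret d T \<pi> I \<ge> c * min (real T) (sqrt (real d * real T * ln (real T)))))))"
proof -
  \<comment> \<open>By monotonicity of \<open>min\<close>, every rate \<open>b\<close> below
    \<open>real d * sqrt (real T)\<close> is covered; both claims are instances.\<close>
  have bound: "\<exists>I. bandit_instance_valid d T I \<and> expected_regret d T \<pi> I \<ge> 1 / 8 * min (real T) b"
    if "d \<ge> 1" "T \<ge> 1" "bandit_policy_valid d T \<pi>" "b \<le> real d * sqrt (real T)" for d T \<pi> b
  proof -
    have "1 / 8 * min (real T) b \<le> 1 / 8 * min (real T) (real d * sqrt (real T))"
      using that(4) by simp
    then show ?thesis
      using regret_lower_bound[OF that(1-3)] by (blast intro: order_trans)
  qed
  have "sqrt (real d * real T) \<le> real d * sqrt (real T)" if "d \<ge> 1" for d T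
  proof -
    have "real d \<le> real d * real d" using that by simp
    then have "sqrt (real d) \<le> real d" by (intro real_le_lsqrt) (simp_all add: power2_eq_square)
    then show ?thesis by (simp add: real_sqrt_mult mult_right_mono)
  qed
  moreover have "sqrt (real d * real (2 ^ m) * ln (real (2 ^ m))) \<le> real d * sqrt (real (2 ^ m))"
    if "m \<in> {1..d}" for d m :: nat
  proof -
    \<comment> \<open>For \<open>T = 2 ^ m\<close> this gives
      \<open>ln T = m * ln 2 \<le> m \<le> d\<close>, so the logarithm costs at most one further
      factor \<open>d\<close> under the root.\<close>
    have "ln (2::real) \<le> 1" using ln_le_minus_one[of "2::real"] by simp
    then have "real m * ln 2 \<le> real d * 1" using that by (intro mult_mono) auto
    then have "ln (real (2 ^ m)) \<le> real d" by (simp add: ln_realpow)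
    then have "real d * real (2 ^ m) * ln (real (2 ^ m)) \<le> real d * real (2 ^ m) * real d"
      by (intro mult_left_mono) auto
    also have "\<dots> = (real d)\<^sup>2 * real (2 ^ m)" by (simp add: power2_eq_square)
    finally have "sqrt (real d * real (2 ^ m) * ln (real (2 ^ m))) \<le> sqrt ((real d)\<^sup>2 * real (2 ^ m))"
      by (rule real_sqrt_le_mono)
    then show ?thesis by (simp add: real_sqrt_mult)
  qed
  ultimately show ?thesis
    by (intro exI[of _ "1 / 8"] conjI allI impI ballI) (simp, blast intro: bound,
      metis bound atLeastAtMost_iff le_trans one_le_numeral one_le_power)
qed

end
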